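(* Let $H$ be an infinite-dimensional separable complex Hilbert space and let $T\in\mathcal{M}_r(H)$ be quasinormal. Then $|T|\in\mathcal{M}_r(H)$.
   Context: $\mathcal{B}(H)$ denotes the bounded linear operators on $H$; $|T|=(T^*T)^{1/2}$; $T$ is quasinormal if $T(T^*T)=(T^*T)T$. For a nonzero Hilbert space $M$ and $A\in\mathcal{B}(M)$, the minimum modulus is $m(A)=\inf\{\|Ax\|: x\in M,\ \|x\|=1\}$; $A$ is minimum attaining if there is a unit vector $x_0\in M$ with $\|Ax_0\|=m(A)$. A closed subspace $M\subseteq H$ reduces $T\in\mathcal{B}(H)$ if $T(M)\subseteq M$ and $T^*(M)\subseteq M$. $\mathcal{M}_r(H)$ is the set of all $T\in\mathcal{B}(H)$ such that for every nonzero closed subspace $M$ reducing $T$, the restriction $T|_M:M\to M$ is minimum attaining. *)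

theory Defs
  imports "HOL-Analysis.Analysis"
begin

text \<open>
  Complex inner product spaces. The inner product is linear in its first argument. The real
  normed structure is the one underlying the complex one, so that the library's notions of
  topology, convergence, completeness and bounded (real-)linear maps apply.
\<close>

class complex_inner = real_normed_vector +
  fixes scaleC :: "complex \<Rightarrow> 'a \<Rightarrow> 'a" (infixr "*\<^sub>C" 75)
    and cinner :: "'a \<Rightarrow> 'a \<Rightarrow> complex"
  assumes scaleC_add_right: "a *\<^sub>C (x + y) = a *\<^sub>C x + a *\<^sub>C y"
    and scaleC_add_left: "(a + b) *\<^sub>C x = a *\<^sub>C x + b *\<^sub>C x"
    and scaleC_scaleC: "a *\<^sub>C (b *\<^sub>C x) = (a * b) *\<^sub>C x"
    and scaleC_one: "1 *\<^sub>C x = x"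
    and scaleR_scaleC: "r *\<^sub>R x = complex_of_real r *\<^sub>C x"
    and cinner_commute: "cinner x y = cnj (cinner y x)"
    and cinner_add_left: "cinner (x + y) z = cinner x z + cinner y z"
    and cinner_scaleC_left: "cinner (a *\<^sub>C x) y = a * cinner x y"
    and cinner_self_nonneg: "cinner x x \<in> \<real>\<^sub>\<ge>\<^sub>0"
    and cinner_self_eq_zero: "cinner x x = 0 \<longleftrightarrow> x = 0"
    and norm_eq_sqrt_cinner: "norm x = sqrt (Re (cinner x x))"

class complex_hilbert_space = complex_inner + complete_space

global_interpretation complex_vector: vector_space "scaleC :: complex \<Rightarrow> 'a \<Rightarrow> 'a::complex_inner"
  by unfold_locales (fact scaleC_add_right scaleC_add_left scaleC_scaleC scaleC_one)+

definition finite_dimensional :: "'a::complex_inner itself \<Rightarrow> bool" where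
  "finite_dimensional _ \<longleftrightarrow> (\<exists>B :: 'a set. finite B \<and> complex_vector.span B = UNIV)"

definition bounded_ops :: "('a::complex_inner \<Rightarrow> 'a) set" where
  "bounded_ops = {T. bounded_linear T \<and> (\<forall>c x. T (c *\<^sub>C x) = c *\<^sub>C T x)}"

text \<open>There is at most one such map; on a Hilbert space it exists for every bounded operator.\<close>

definition cadjoint :: "('a::complex_inner \<Rightarrow> 'a) \<Rightarrow> 'a \<Rightarrow> 'a" where
  "cadjoint T = (THE S. \<forall>x y. cinner (T x) y = cinner x (S y))"

definition positive_op :: "('a::complex_inner \<Rightarrow> 'a) \<Rightarrow> bool" where
  "positive_op A \<longleftrightarrow> A \<in> bounded_ops \<and> (\<forall>x. cinner (A x) x \<in> \<real>\<^sub>\<ge>\<^sub>0)"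

text \<open>The positive square root, unique for a positive operator on a Hilbert space.\<close>

definition sqrt_op :: "('a::complex_inner \<Rightarrow> 'a) \<Rightarrow> 'a \<Rightarrow> 'a" where
  "sqrt_op A = (THE S. positive_op S \<and> S \<circ> S = A)"

definition abs_op :: "('a::complex_inner \<Rightarrow> 'a) \<Rightarrow> 'a \<Rightarrow> 'a" where
  "abs_op T = sqrt_op (cadjoint T \<circ> T)"

definition quasinormal :: "('a::complex_inner \<Rightarrow> 'a) \<Rightarrow> bool" where
  "quasinormal T \<longleftrightarrow> T \<circ> (cadjoint T \<circ> T) = (cadjoint T \<circ> T) \<circ> T"

definition closed_csubspace :: "'a::complex_inner set \<Rightarrow> bool" where
  "closed_csubspace M \<longleftrightarrow> complex_vector.subspace M \<and> closed M"

definition reduces :: "'a::complex_inner set \<Rightarrow> ('a \<Rightarrow> 'a) \<Rightarrow> bool" where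
  "reduces M T \<longleftrightarrow> closed_csubspace M \<and> T ` M \<subseteq> M \<and> cadjoint T ` M \<subseteq> M"

text \<open>
  The restriction of \<open>A\<close> to an invariant subspace \<open>M\<close> is represented by the pair of \<open>M\<close> and \<open>A\<close>:
  only the values of \<open>A\<close> on \<open>M\<close> enter. The subspace is meant to be nonzero, as the infimum
  would otherwise range over the empty set.
\<close>

definition min_modulus_on :: "'a::complex_inner set \<Rightarrow> ('a \<Rightarrow> 'a) \<Rightarrow> real" where
  "min_modulus_on M A = (INF x\<in>{x \<in> M. norm x = 1}. norm (A x))"

definition min_attaining_on :: "'a::complex_inner set \<Rightarrow> ('a \<Rightarrow> 'a) \<Rightarrow> bool" where
  "min_attaining_on M A \<longleftrightarrow> (\<exists>x0\<in>M. norm x0 = 1 \<and> norm (A x0) = min_modulus_on M A)"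

definition min_attaining_reducing :: "('a::complex_inner \<Rightarrow> 'a) set" (\<open>\<M>\<^sub>r\<close>) where
  "\<M>\<^sub>r = {T \<in> bounded_ops. \<forall>M. M \<noteq> {0} \<and> reduces M T \<longrightarrow> min_attaining_on M T}"

end

theory Submission
  imports Defs
begin

text \<open>
  Write \<open>A = T\<^sup>*T\<close>. Since \<open>\<parallel>|T|x\<parallel> = \<parallel>Tx\<parallel>\<close> and every subspace reducing \<open>|T|\<close> is invariant under
  \<open>A\<close>, it suffices that \<open>T\<close> attains its minimum modulus \<open>m\<close> on every \<open>A\<close>-invariant \<open>M \<noteq> 0\<close>,
  although \<open>M\<close> need not reduce \<open>T\<close>. If it did not, \<open>M\<close> would contain no eigenvector of \<open>A\<close> for
  \<open>\<mu> = m\<^sup>2\<close>, hence be orthogonal to \<open>ker (A - \<mu>)\<close>. So \<open>M\<close> lies in the part \<open>N\<close> of the spectral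
  subspace of \<open>A\<close> for \<open>[\<mu>, \<infinity>)\<close> that is orthogonal to \<open>ker (A - \<mu>)\<close>. By quasinormality \<open>T\<close> and
  \<open>T\<^sup>*\<close> commute with \<open>A\<close>, so \<open>N\<close> reduces \<open>T\<close>; the minimum of \<open>T\<close> on \<open>N\<close> is again \<open>m\<close>, and it is
  attained at an eigenvector of \<open>A\<close> for \<open>\<mu>\<close> lying in \<open>N\<close>, which is absurd. The spectral theorem is
  not needed: with \<open>S = c - A \<ge> 0\<close> and \<open>r = c - \<mu>\<close> the spectral subspace consists of the \<open>x\<close> with
  \<open>\<parallel>S\<^sup>n x\<parallel> \<le> C r\<^sup>n\<close> for all \<open>n\<close>, and log-convexity of \<open>n \<mapsto> \<parallel>S\<^sup>n x\<parallel>\<close> allows \<open>C = \<parallel>x\<parallel>\<close>.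
\<close>

section \<open>Complex inner products\<close>

lemma cinner_add_right: "cinner x (y + z) = cinner x y + cinner (x::'a::complex_inner) z"
  using cinner_commute[of x "y + z"] cinner_commute[of x y] cinner_commute[of x z]
  by (simp add: cinner_add_left)

lemma cinner_scaleC_right: "cinner x (a *\<^sub>C y) = cnj a * cinner (x::'a::complex_inner) y"
  using cinner_commute[of x "a *\<^sub>C y"] cinner_commute[of x y] by (simp add: cinner_scaleC_left)

lemma cinner_scaleR_left: "cinner (a *\<^sub>R x) y = of_real a * cinner (x::'a::complex_inner) y"
  by (simp add: scaleR_scaleC cinner_scaleC_left)

lemma cinner_scaleR_right: "cinner x (a *\<^sub>R y) = of_real a * cinner (x::'a::complex_inner) y"
  by (simp add: scaleR_scaleC cinner_scaleC_right)

lemma cinner_minus_left: "cinner (- x) y = - cinner (x::'a::complex_inner) y"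
  using cinner_scaleR_left[of "-1" x y] by simp

lemma cinner_minus_right: "cinner x (- y) = - cinner (x::'a::complex_inner) y"
  using cinner_scaleR_right[of x "-1" y] by simp

lemma cinner_diff_left: "cinner (x - y) z = cinner x z - cinner (y::'a::complex_inner) z"
  using cinner_add_left[of x "- y" z] by (simp add: cinner_minus_left)

lemma cinner_diff_right: "cinner x (y - z) = cinner x y - cinner (x::'a::complex_inner) z"
  using cinner_add_right[of x y "- z"] by (simp add: cinner_minus_right)

lemma cinner_zero_left [simp]: "cinner 0 (x::'a::complex_inner) = 0"
  using cinner_scaleR_left[of 0 x x] by simp

lemma cinner_zero_right [simp]: "cinner (x::'a::complex_inner) 0 = 0"
  using cinner_scaleR_right[of x 0 x] by simp

lemmas cinner_simps =
  cinner_add_left cinner_add_right cinner_diff_left cinner_diff_right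
  cinner_scaleR_left cinner_scaleR_right cinner_scaleC_left cinner_scaleC_right
  cinner_minus_left cinner_minus_right

lemma cinner_self: "cinner x x = of_real ((norm (x::'a::complex_inner))\<^sup>2)"
proof -
  obtain r where "r \<ge> 0" "cinner x x = of_real r"
    using cinner_self_nonneg[of x] by (auto simp: nonneg_Reals_def)
  then show ?thesis by (simp add: norm_eq_sqrt_cinner)
qed

lemma Re_cinner_commute: "Re (cinner x y) = Re (cinner (y::'a::complex_inner) x)"
  using cinner_commute[of x y] by simp

lemma power2_norm_cinner: "(norm (x::'a::complex_inner))\<^sup>2 = Re (cinner x x)"
  by (simp add: cinner_self)

lemma norm_add_sq: "(norm (x + y))\<^sup>2 = (norm x)\<^sup>2 + 2 * Re (cinner x y) + (norm (y::'a::complex_inner))\<^sup>2"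
  unfolding power2_norm_cinner by (simp add: cinner_simps Re_cinner_commute[of y x])

lemma norm_diff_sq: "(norm (x - y))\<^sup>2 = (norm x)\<^sup>2 - 2 * Re (cinner x y) + (norm (y::'a::complex_inner))\<^sup>2"
  unfolding power2_norm_cinner by (simp add: cinner_simps Re_cinner_commute[of y x])

lemma norm_scaleC: "norm (a *\<^sub>C x) = cmod a * norm (x::'a::complex_inner)"
proof -
  have "(norm (a *\<^sub>C x))\<^sup>2 = Re (a * cnj a * cinner x x)"
    unfolding power2_norm_cinner by (simp add: cinner_simps mult.assoc mult.left_commute)
  also have "\<dots> = (cmod a * norm x)\<^sup>2"
    by (simp only: complex_norm_square[symmetric] cinner_self of_real_mult[symmetric]
        Re_complex_of_real power_mult_distrib)
  finally show ?thesis by simp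
qed

text \<open>Cauchy-Schwarz: the squared norm of
  \<open>norm y *\<^sub>R x - norm x *\<^sub>R y\<close> expands to the required difference times a
  positive factor.\<close>

lemma Re_cinner_le: "Re (cinner x y) \<le> norm x * norm (y::'a::complex_inner)"
proof (cases "x = 0 \<or> y = 0")
  case False
  then have p: "norm x > 0" "norm y > 0" by auto
  have "0 \<le> (norm (norm y *\<^sub>R x - norm x *\<^sub>R y))\<^sup>2" by simp
  also have "\<dots> = 2 * (norm x * norm y) * (norm x * norm y - Re (cinner x y))"
    unfolding norm_diff_sq by (simp add: cinner_simps power2_eq_square algebra_simps)
  finally have "0 \<le> (norm x * norm y) * (norm x * norm y - Re (cinner x y))" by simp
  moreover have "0 < norm x * norm y" using p by simp
  ultimately have "0 \<le> norm x * norm y - Re (cinner x y)" by (metis mult_le_cancel_left_pos mult_zero_right)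
  then show ?thesis by simp
qed auto

lemma norm_cinner_le: "cmod (cinner x y) \<le> norm x * norm (y::'a::complex_inner)"
proof (cases "cinner x y = 0")
  case False
  \<comment> \<open>The phase \<open>u\<close> has modulus 1 and turns \<open>cinner x y\<close>
    into its absolute value, which reduces the claim to real parts.\<close>
  define u where "u = cnj (sgn (cinner x y))"
  have "u * cinner x y = of_real (cmod (cinner x y))"
    using False unfolding u_def sgn_eq
    by (simp add: field_simps complex_norm_square[symmetric] power2_eq_square)
  then have "cmod (cinner x y) = Re (cinner (u *\<^sub>C x) y)"
    by (simp add: cinner_simps)
  also have "\<dots> \<le> norm (u *\<^sub>C x) * norm y" by (rule Re_cinner_le)
  also have "norm (u *\<^sub>C x) = norm x"
    using False by (simp add: norm_scaleC u_def norm_sgn)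
  finally show ?thesis .
qed auto

lemma cinner_eqI: "(\<And>x. cinner x y = cinner x z) \<Longrightarrow> y = (z::'a::complex_inner)"
  using cinner_self_eq_zero[of "y - z"] by (simp add: cinner_diff_right)

lemma continuous_on_cinner_left: "continuous_on UNIV (\<lambda>x. cinner x (y::'a::complex_inner))"
proof -
  have "bounded_linear (\<lambda>x. cinner x y)"
    by (rule bounded_linear_intro[where K = "norm y"])
      (simp_all add: cinner_simps norm_cinner_le scaleR_conv_of_real)
  then show ?thesis
    by (simp add: linear_continuous_on)
qed

section \<open>Riesz representation and adjoints\<close>

lemma closed_csubspace_UNIV: "closed_csubspace UNIV"
  by (simp add: closed_csubspace_def)

lemma closed_csubspace_scaleR:
  "closed_csubspace M \<Longrightarrow> x \<in> M \<Longrightarrow> a *\<^sub>R x \<in> (M::'a::complex_inner set)"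
  by (simp add: closed_csubspace_def scaleR_scaleC complex_vector.subspace_scale)

lemma closed_csubspace_add:
  "closed_csubspace M \<Longrightarrow> x \<in> M \<Longrightarrow> y \<in> M \<Longrightarrow> x + y \<in> (M::'a::complex_inner set)"
  by (simp add: closed_csubspace_def complex_vector.subspace_add)

lemma closed_csubspace_diff:
  "closed_csubspace M \<Longrightarrow> x \<in> M \<Longrightarrow> y \<in> M \<Longrightarrow> x - y \<in> (M::'a::complex_inner set)"
  by (simp add: closed_csubspace_def complex_vector.subspace_diff)

lemma closed_csubspace_Int:
  "closed_csubspace M \<Longrightarrow> closed_csubspace N \<Longrightarrow> closed_csubspace (M \<inter> N)"
  by (auto simp: closed_csubspace_def complex_vector.subspace_inter)

text \<open>First-order condition at a minimum: otherwise the linear term wins at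
  \<open>t = - (b / q)\<close> for any positive \<open>q > a\<close>.\<close>

lemma linear_coeff_zero:
  fixes a b :: real
  assumes "\<And>t. 0 \<le> t\<^sup>2 * a + 2 * t * b"
  shows "b = 0"
proof (rule ccontr)
  assume "b \<noteq> 0"
  define q where "q = \<bar>a\<bar> + 1"
  have q: "q > 0" "a < q" by (auto simp: q_def)
  have "0 \<le> (- (b / q))\<^sup>2 * a + 2 * (- (b / q)) * b" by (rule assms)
  also have "\<dots> = (b / q)\<^sup>2 * (a - 2 * q)"
    using q by (simp add: field_simps power2_eq_square)
  also have "\<dots> < 0"
    using q \<open>b \<noteq> 0\<close> by (intro mult_pos_neg) auto
  finally show False by simp
qed

text \<open>The representing vector minimises \<open>\<parallel>x\<parallel>\<^sup>2 - 2 Re (f x)\<close> over \<open>M\<close>. Taking \<open>M = UNIV\<close> gives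
  Riesz' theorem, and \<open>f = (\<lambda>x. cinner x y)\<close> the orthogonal projection of \<open>y\<close> onto \<open>M\<close>.\<close>

lemma riesz_on_closed_csubspace:
  fixes f :: "'a::complex_hilbert_space \<Rightarrow> complex"
  assumes M: "closed_csubspace M"
    and add: "\<And>x y. f (x + y) = f x + f y"
    and scale: "\<And>a x. f (a *\<^sub>C x) = a * f x"
    and bound: "\<And>x. cmod (f x) \<le> K * norm x"
  shows "\<exists>z\<in>M. \<forall>x\<in>M. f x = cinner x z"
proof -
  define J where "J x = (norm x)\<^sup>2 - 2 * Re (f x)" for x
  have scaleR: "f (a *\<^sub>R x) = of_real a * f x" for a x
    by (simp add: scaleR_scaleC scale)
  have "bounded_linear f"
    by (rule bounded_linear_intro[where K = K])
      (simp_all add: add scaleR bound scaleR_conv_of_real mult.commute)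
  then have contf: "continuous_on UNIV f" by (rule linear_continuous_on)
  have contJ: "continuous_on UNIV J"
    unfolding J_def by (intro continuous_intros contf)
  \<comment> \<open>Completing the square: \<open>J x\<close> is at least
    \<open>(norm x - K)\<^sup>2 - K\<^sup>2\<close>.\<close>
  have lower: "- K\<^sup>2 \<le> J x" for x
  proof -
    have "Re (f x) \<le> K * norm x" using bound[of x] complex_Re_le_cmod[of "f x"] by linarith
    moreover have "0 \<le> (norm x - K)\<^sup>2" by simp
    ultimately show ?thesis by (simp add: J_def power2_diff mult.commute)
  qed
  define d where "d = Inf (J ` M)"
  have zM: "0 \<in> M" using M by (simp add: closed_csubspace_def complex_vector.subspace_0)
  have bdd: "bdd_below (J ` M)" using lower by (auto intro: bdd_belowI[where m = "- K\<^sup>2"])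
  have dle: "d \<le> J x" if "x \<in> M" for x
    unfolding d_def using that bdd by (simp add: cINF_lower)
  have "\<exists>x\<in>M. J x < d + 1 / Suc n" for n
  proof -
    have "Inf (J ` M) < d + 1 / Suc n" by (simp add: d_def)
    then show ?thesis using cInf_lessD[of "J ` M"] zM by blast
  qed
  then obtain X where X: "\<And>n. X n \<in> M" "\<And>n. J (X n) < d + 1 / Suc n" by metis
  \<comment> \<open>Parallelogram law: the midpoint stays in \<open>M\<close>, so \<open>J\<close>
    is at least \<open>d\<close> there. This makes minimising sequences Cauchy.\<close>
  have par: "(norm (x - y))\<^sup>2 \<le> 2 * (J x - d) + 2 * (J y - d)" if "x \<in> M" "y \<in> M" for x y
  proof -
    have "(1/2) *\<^sub>R (x + y) \<in> M"
      using that M by (intro closed_csubspace_scaleR closed_csubspace_add)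
    then have "d \<le> J ((1/2) *\<^sub>R (x + y))" by (rule dle)
    also have "\<dots> = (norm (x + y))\<^sup>2 / 4 - Re (f x) - Re (f y)"
      by (simp add: J_def scaleR add power_divide add_divide_distrib)
    finally show ?thesis
      unfolding norm_add_sq norm_diff_sq J_def by argo
  qed
  have "Cauchy X"
  proof (rule metric_CauchyI)
    fix e :: real assume "e > 0"
    then obtain n0 where n0: "1 / Suc n0 < e\<^sup>2 / 4"
      using nat_approx_posE[of "e\<^sup>2 / 4"] by auto
    have "dist (X m) (X n) < e" if "m \<ge> n0" "n \<ge> n0" for m n
    proof -
      have "1 / Suc m \<le> 1 / Suc n0" "1 / Suc n \<le> 1 / Suc n0"
        using that by (auto simp: field_simps)
      then have "J (X m) - d < e\<^sup>2 / 4" "J (X n) - d < e\<^sup>2 / 4"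
        using X(2)[of m] X(2)[of n] n0 by argo+
      then have "(norm (X m - X n))\<^sup>2 < e\<^sup>2"
        using par[OF X(1) X(1), of m n] by argo
      then show ?thesis
        unfolding dist_norm by (rule power2_less_imp_less) (use \<open>e > 0\<close> in simp)
    qed
    then show "\<exists>M. \<forall>m\<ge>M. \<forall>n\<ge>M. dist (X m) (X n) < e" by blast
  qed
  then obtain z where z: "X \<longlonglongrightarrow> z"
    using Cauchy_convergent convergent_def by blast
  have "z \<in> M"
    using M z X(1) unfolding closed_csubspace_def by (metis closed_sequentially)
  have "(\<lambda>n. J (X n)) \<longlonglongrightarrow> J z"
    using contJ z by (simp add: continuous_on_eq_continuous_at isCont_tendsto_compose)
  moreover have "(\<lambda>n. d + 1 / Suc n) \<longlonglongrightarrow> d + 0"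
    using lim_1_over_n by (intro tendsto_intros) (rule LIMSEQ_Suc)
  ultimately have "J z \<le> d + 0"
    by (rule LIMSEQ_le) (use X(2) in \<open>auto intro: less_imp_le\<close>)
  then have Jz: "J z \<le> J x" if "x \<in> M" for x using dle[OF that] by simp
  \<comment> \<open>First variation of \<open>J\<close> at the minimiser \<open>z\<close> in
    direction \<open>x\<close>.\<close>
  have re: "Re (f x) = Re (cinner x z)" if "x \<in> M" for x
  proof -
    have "0 \<le> t\<^sup>2 * (norm x)\<^sup>2 + 2 * t * (Re (cinner x z) - Re (f x))" for t
    proof -
      have "z + t *\<^sub>R x \<in> M"
        using that \<open>z \<in> M\<close> M by (intro closed_csubspace_scaleR closed_csubspace_add)
      from Jz[OF this] show ?thesis
        by (simp add: J_def norm_add_sq add scaleR cinner_simps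
            Re_cinner_commute[of z x] algebra_simps)
    qed
    from linear_coeff_zero[OF this] show ?thesis by simp
  qed
  have "f x = cinner x z" if "x \<in> M" for x
  proof (rule complex_eqI)
    \<comment> \<open>The real-part identity at \<open>\<i> *\<^sub>C x\<close> is the
      imaginary-part identity at \<open>x\<close>.\<close>
    have "\<i> *\<^sub>C x \<in> M"
      using M that by (simp add: closed_csubspace_def complex_vector.subspace_scale)
    from re[OF this] show "Im (f x) = Im (cinner x z)" by (simp add: scale cinner_simps)
  qed (rule re[OF that])
  with \<open>z \<in> M\<close> show ?thesis by blast
qed

lemma projection_exists:
  fixes y :: "'a::complex_hilbert_space"
  assumes "closed_csubspace M"
  shows "\<exists>z\<in>M. \<forall>x\<in>M. cinner x (y - z) = 0"
  using riesz_on_closed_csubspace[OF assms, of "\<lambda>x. cinner x y" "norm y"]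
  by (auto simp: cinner_simps norm_cinner_le mult.commute)

section \<open>Bounded operators and their adjoints\<close>

lemma bounded_opsI:
  assumes "\<And>x y. T (x + y) = T x + T y" "\<And>c x. T (c *\<^sub>C x) = c *\<^sub>C T x"
    and "\<And>x. norm (T x) \<le> K * norm x"
  shows "T \<in> bounded_ops"
  using assms unfolding bounded_ops_def
  by (auto simp: scaleR_scaleC mult.commute intro!: bounded_linear_intro[where K = K])

lemma bounded_ops_bounded_linear: "T \<in> bounded_ops \<Longrightarrow> bounded_linear T"
  by (simp add: bounded_ops_def)

lemma bounded_ops_scaleC: "T \<in> bounded_ops \<Longrightarrow> T (c *\<^sub>C x) = c *\<^sub>C T x"
  by (simp add: bounded_ops_def)

lemmas bounded_ops_simps =
  bounded_ops_bounded_linear[THEN bounded_linear.linear, THEN linear_add]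
  bounded_ops_bounded_linear[THEN bounded_linear.linear, THEN linear_diff]
  bounded_ops_bounded_linear[THEN bounded_linear.linear, THEN linear_scale]
  bounded_ops_bounded_linear[THEN bounded_linear.linear, THEN linear_0]
  bounded_ops_scaleC

lemma bounded_ops_bound:
  assumes "T \<in> bounded_ops"
  obtains K where "K > 0" "\<And>x. norm (T x) \<le> K * norm x"
  using bounded_linear.pos_bounded[OF bounded_ops_bounded_linear[OF assms]]
  by (metis mult.commute)

lemma bounded_ops_comp:
  assumes "S \<in> bounded_ops" "T \<in> bounded_ops"
  shows "S \<circ> T \<in> bounded_ops"
  using assms by (auto simp: bounded_ops_def o_def intro: bounded_linear_compose)

text \<open>Riesz' theorem for \<open>\<lambda>x. cinner (T x) y\<close> supplies an adjoint map,
  and \<open>cinner_eqI\<close> makes it unique, so the \<open>THE\<close> in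
  \<open>cadjoint\<close> denotes it.\<close>

lemma cinner_cadjoint:
  fixes T :: "'a::complex_hilbert_space \<Rightarrow> 'a"
  assumes T: "T \<in> bounded_ops"
  shows "cinner (T x) y = cinner x (cadjoint T y)"
proof -
  obtain K where K: "K > 0" "\<And>x. norm (T x) \<le> K * norm x"
    using bounded_ops_bound[OF T] by blast
  have "\<exists>z. \<forall>x. cinner (T x) y = cinner x z" for y
  proof -
    have "cmod (cinner (T x) y) \<le> (K * norm y) * norm x" for x
      using norm_cinner_le[of "T x" y] mult_right_mono[OF K(2)[of x], of "norm y"]
      by (simp add: algebra_simps)
    from riesz_on_closed_csubspace[OF closed_csubspace_UNIV _ _ this]
    show ?thesis by (simp add: bounded_ops_simps[OF T] cinner_simps)
  qed
  then obtain S where S: "\<And>x y. cinner (T x) y = cinner x (S y)" by metis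
  have "\<forall>x y. cinner (T x) y = cinner x (cadjoint T y)"
    unfolding cadjoint_def
  proof (rule theI[of _ S])
    show "R = S" if "\<forall>x y. cinner (T x) y = cinner x (R y)" for R
      using that S by (intro ext cinner_eqI) metis
  qed (use S in blast)
  then show ?thesis by blast
qed

lemma cadjoint_bounded_ops:
  fixes T :: "'a::complex_hilbert_space \<Rightarrow> 'a"
  assumes T: "T \<in> bounded_ops"
  shows "cadjoint T \<in> bounded_ops"
proof -
  obtain K where K: "K > 0" "\<And>x. norm (T x) \<le> K * norm x"
    using bounded_ops_bound[OF T] by blast
  show ?thesis
  proof (rule bounded_opsI)
    show "cadjoint T (x + y) = cadjoint T x + cadjoint T y" for x y
      by (rule cinner_eqI) (simp add: cinner_simps flip: cinner_cadjoint[OF T])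
    show "cadjoint T (c *\<^sub>C x) = c *\<^sub>C cadjoint T x" for c x
      by (rule cinner_eqI) (simp add: cinner_simps flip: cinner_cadjoint[OF T])
    \<comment> \<open>The square of the left side is \<open>cinner (T (cadjoint T y)) y\<close>;
      Cauchy-Schwarz and the bound on \<open>T\<close> leave one factor to cancel.\<close>
    show "norm (cadjoint T y) \<le> K * norm y" for y
    proof (cases "cadjoint T y = 0")
      case False
      have "(norm (cadjoint T y))\<^sup>2 = Re (cinner (T (cadjoint T y)) y)"
        by (simp add: power2_norm_cinner cinner_cadjoint[OF T])
      also have "\<dots> \<le> norm (T (cadjoint T y)) * norm y" by (rule Re_cinner_le)
      also have "\<dots> \<le> (K * norm (cadjoint T y)) * norm y"
        by (intro mult_right_mono K) simp
      finally show ?thesis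
        using False by (simp add: power2_eq_square mult.assoc mult.left_commute)
    qed (use K in auto)
  qed
qed

section \<open>Positive operators and their square roots\<close>

text \<open>Self-adjointness stated without \<open>cadjoint\<close>, so that it is meaningful
  without completeness and before boundedness is known.\<close>

definition symmetric_op :: "('a::complex_inner \<Rightarrow> 'a) \<Rightarrow> bool" where
  "symmetric_op S \<longleftrightarrow> (\<forall>x y. cinner (S x) y = cinner x (S y))"

lemma symmetric_opD: "symmetric_op S \<Longrightarrow> cinner (S x) y = cinner x (S y)"
  by (simp add: symmetric_op_def)

text \<open>Polarisation: the quadratic form is real at \<open>x + y\<close> and at
  \<open>x + \<i> *\<^sub>C y\<close>, which ties the two mixed terms together as
  conjugates.\<close>

lemma positive_op_symmetric:
  assumes "positive_op A"
  shows "symmetric_op A"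
  unfolding symmetric_op_def
proof (intro allI)
  fix x y
  have A: "A \<in> bounded_ops" and re: "\<And>x. Im (cinner (A x) x) = 0"
    using assms by (auto simp: positive_op_def complex_nonneg_Reals_iff)
  define u v where "u = cinner (A x) y" and "v = cinner (A y) x"
  have "Im (u + v) = 0"
    using re[of "x + y"] re[of x] re[of y]
    by (simp add: bounded_ops_simps[OF A] cinner_simps u_def v_def)
  moreover have "Re (v - u) = 0"
    using re[of "x + \<i> *\<^sub>C y"] re[of x] re[of y]
    by (simp add: bounded_ops_simps[OF A] cinner_simps u_def v_def)
  ultimately have "u = cnj v" by (simp add: complex_eq_iff)
  then show "cinner (A x) y = cinner x (A y)"
    using cinner_commute[of x "A y"] by (simp add: u_def v_def)
qed

lemma positive_opI:
  assumes "A \<in> bounded_ops" "symmetric_op A" "\<And>x. 0 \<le> Re (cinner (A x) x)"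
  shows "positive_op A"
proof -
  have "Im (cinner (A x) x) = 0" for x
    using cinner_commute[of "A x" x] symmetric_opD[OF assms(2), of x x]
    by (simp add: complex_eq_iff)
  then show ?thesis
    using assms by (simp add: positive_op_def complex_nonneg_Reals_iff)
qed

lemma positive_op_Re: "positive_op A \<Longrightarrow> 0 \<le> Re (cinner (A x) x)"
  by (auto simp: positive_op_def complex_nonneg_Reals_iff)

text \<open>The operator inequality \<open>S\<^sup>2 \<le> r S\<close> for
  \<open>0 \<le> S \<le> r\<close>, by expanding the form at \<open>x - (1/r) *\<^sub>R S x\<close>.
  The bounds are demanded only at the two vectors used, so the lemma also applies inside an
  invariant subspace.\<close>

lemma norm_sq_le_quadratic_form:
  assumes S: "S \<in> bounded_ops" "symmetric_op S" and r: "r > 0"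
    and x: "0 \<le> Re (cinner (S (x - (1/r) *\<^sub>R S x)) (x - (1/r) *\<^sub>R S x))"
    and Sx: "Re (cinner (S (S x)) (S x)) \<le> r * (norm (S x))\<^sup>2"
  shows "(norm (S x))\<^sup>2 \<le> r * Re (cinner (S x) x)"
proof -
  have "0 \<le> Re (cinner (S x) x) - (2/r) * (norm (S x))\<^sup>2 + (1/r)\<^sup>2 * Re (cinner (S (S x)) (S x))"
    using x by (simp add: bounded_ops_simps[OF S(1)] cinner_simps symmetric_opD[OF S(2), of "S x" x]
        cinner_self power2_eq_square algebra_simps)
  also have "\<dots> \<le> Re (cinner (S x) x) - (2/r) * (norm (S x))\<^sup>2 + (1/r)\<^sup>2 * (r * (norm (S x))\<^sup>2)"
    using Sx by (intro add_left_mono mult_left_mono) auto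
  also have "\<dots> = Re (cinner (S x) x) - (norm (S x))\<^sup>2 / r"
    using r by (simp add: field_simps power2_eq_square)
  finally show ?thesis using r by (simp add: field_simps)
qed

lemma quadratic_form_le:
  assumes "norm (T x) \<le> K * norm (x::'a::complex_inner)"
  shows "Re (cinner (T x) x) \<le> K * (norm x)\<^sup>2"
  using Re_cinner_le[of "T x" x] mult_right_mono[OF assms, of "norm x"]
  by (simp add: power2_eq_square)

text \<open>With \<open>K\<close> a norm bound, \<open>S\<^sup>2 \<le> K S\<close>, so a vanishing
  form forces \<open>S x = 0\<close>.\<close>

lemma positive_op_kernel:
  assumes S: "positive_op S" and x: "Re (cinner (S x) x) = 0"
  shows "S x = 0"
proof -
  have b: "S \<in> bounded_ops" using S by (simp add: positive_op_def)
  obtain K where K: "K > 0" "\<And>x. norm (S x) \<le> K * norm x" using bounded_ops_bound[OF b] by blast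
  have "(norm (S x))\<^sup>2 \<le> K * Re (cinner (S x) x)"
    by (rule norm_sq_le_quadratic_form[where S = S and r = K and x = x,
          OF b positive_op_symmetric[OF S] K(1) positive_op_Re[OF S] quadratic_form_le[of S, OF K(2)]])
  then show ?thesis using x by simp
qed

section \<open>Iteration for the square root\<close>

primrec sqrt_iter :: "('a::real_vector \<Rightarrow> 'a) \<Rightarrow> nat \<Rightarrow> 'a \<Rightarrow> 'a" where
  "sqrt_iter B 0 = (\<lambda>x. 0)"
| "sqrt_iter B (Suc n) = (\<lambda>x. (1/2) *\<^sub>R (B x + sqrt_iter B n (sqrt_iter B n x)))"

text \<open>The same iteration for the scalar \<open>B = 1\<close>; it majorises the norms and the
  increments of the operator iterates.\<close>

primrec sqrt_bound :: "nat \<Rightarrow> real" where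
  "sqrt_bound 0 = 0"
| "sqrt_bound (Suc n) = (1 + (sqrt_bound n)\<^sup>2) / 2"

lemma sqrt_bound_range: "0 \<le> sqrt_bound n \<and> sqrt_bound n \<le> 1"
  by (induction n) (auto simp: power_le_one)

lemma sqrt_bound_mono: "sqrt_bound n \<le> sqrt_bound (Suc n)"
proof -
  have "0 \<le> (1 - sqrt_bound n)\<^sup>2" by simp
  then show ?thesis by (simp add: power2_diff)
qed

lemma sqrt_bound_convergent: "convergent sqrt_bound"
  using Bseq_mono_convergent[of sqrt_bound] sqrt_bound_range
  by (metis incseq_SucI incseq_def sqrt_bound_mono BseqI' abs_of_nonneg real_norm_def)

lemma sqrt_iter_linear:
  assumes B: "B \<in> bounded_ops"
  shows "sqrt_iter B n (x + y) = sqrt_iter B n x + sqrt_iter B n y"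
    and "sqrt_iter B n (c *\<^sub>C x) = c *\<^sub>C sqrt_iter B n x"
proof -
  show "sqrt_iter B n (x + y) = sqrt_iter B n x + sqrt_iter B n y" for x y
    by (induction n arbitrary: x y) (simp_all add: bounded_ops_simps[OF B] algebra_simps)
  show "sqrt_iter B n (c *\<^sub>C x) = c *\<^sub>C sqrt_iter B n x" for x
    by (induction n arbitrary: x)
      (simp_all add: bounded_ops_simps[OF B] complex_vector.scale_right_distrib scaleR_scaleC
        complex_vector.scale_left_commute)
qed

lemma sqrt_iter_diff:
  assumes "B \<in> bounded_ops"
  shows "sqrt_iter B n (x - y) = sqrt_iter B n x - sqrt_iter B n y"
  using sqrt_iter_linear(1)[OF assms, of n "x - y" y] by simp

lemma sqrt_iter_symmetric:
  assumes "symmetric_op B"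
  shows "symmetric_op (sqrt_iter B n)"
  by (induction n) (use assms in \<open>simp_all add: symmetric_op_def cinner_simps\<close>)

text \<open>The iterates are real polynomials in \<open>B\<close>.\<close>

lemma sqrt_iter_commute:
  assumes C: "bounded_linear C" and "C \<circ> B = B \<circ> C"
  shows "C (sqrt_iter B n x) = sqrt_iter B n (C x)"
proof (induction n arbitrary: x)
  case (Suc n)
  have "C (B x) = B (C x)" using assms(2) by (metis comp_apply)
  then show ?case
    by (simp add: Suc linear_scale[OF bounded_linear.linear[OF C]]
        linear_add[OF bounded_linear.linear[OF C]])
qed (simp add: linear_0[OF bounded_linear.linear[OF C]])

lemma sqrt_iter_bound:
  assumes "\<And>x. norm (B x) \<le> norm x"
  shows "norm (sqrt_iter B n x) \<le> sqrt_bound n * norm x"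
proof (induction n arbitrary: x)
  case (Suc n)
  let ?Y = "sqrt_iter B n"
  have "norm (?Y (?Y x)) \<le> sqrt_bound n * (sqrt_bound n * norm x)"
    using Suc[of "?Y x"] mult_left_mono[OF Suc[of x], of "sqrt_bound n"] sqrt_bound_range[of n]
    by linarith
  then have "norm (B x + ?Y (?Y x)) \<le> norm x + (sqrt_bound n)\<^sup>2 * norm x"
    using assms[of x] norm_triangle_ineq[of "B x" "?Y (?Y x)"]
    by (simp add: power2_eq_square mult.assoc)
  moreover have "norm (sqrt_iter B (Suc n) x) = norm (B x + ?Y (?Y x)) / 2"
    by (simp only: sqrt_iter.simps norm_scaleR)
  ultimately show ?case by (simp add: field_simps del: sqrt_iter.simps)
qed simp

text \<open>Increments are dominated by those of the convergent scalar sequence, which telescope;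
  this yields the Cauchy property.\<close>

lemma sqrt_iter_step:
  assumes B: "B \<in> bounded_ops" "\<And>x. norm (B x) \<le> norm x"
  shows "norm (sqrt_iter B (Suc n) x - sqrt_iter B n x)
    \<le> (sqrt_bound (Suc n) - sqrt_bound n) * norm x"
proof (induction n arbitrary: x)
  case (Suc n)
  let ?Y = "sqrt_iter B n" and ?Z = "sqrt_iter B (Suc n)"
  let ?y = "sqrt_bound n" and ?z = "sqrt_bound (Suc n)"
  have "sqrt_iter B (Suc (Suc n)) x - ?Z x = (1/2) *\<^sub>R (?Z (?Z x) - ?Y (?Y x))"
    unfolding sqrt_iter.simps(2)[of B "Suc n"]
    by (subst (3) sqrt_iter.simps(2)) (simp only: scaleR_diff_right[symmetric], simp)
  \<comment> \<open>Operator version of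
    \<open>z\<^sup>2 - y\<^sup>2 = z (z - y) + (z - y) y\<close>, so the scalar identity matches the
    estimate exactly.\<close>
  also have "?Z (?Z x) - ?Y (?Y x) = ?Z (?Z x - ?Y x) + (?Z (?Y x) - ?Y (?Y x))"
    unfolding sqrt_iter_diff[OF B(1)] by simp
  finally have "norm (sqrt_iter B (Suc (Suc n)) x - ?Z x)
      \<le> (norm (?Z (?Z x - ?Y x)) + norm (?Z (?Y x) - ?Y (?Y x))) / 2"
    using norm_triangle_ineq by (simp del: sqrt_iter.simps)
  moreover have "norm (?Z (?Z x - ?Y x)) \<le> ?z * ((?z - ?y) * norm x)"
    using sqrt_iter_bound[OF B(2), of "Suc n" "?Z x - ?Y x"] mult_left_mono[OF Suc[of x], of ?z]
      sqrt_bound_range[of "Suc n"] by linarith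
  moreover have "norm (?Z (?Y x) - ?Y (?Y x)) \<le> (?z - ?y) * (?y * norm x)"
    using Suc[of "?Y x"] mult_left_mono[OF sqrt_iter_bound[OF B(2), of n x], of "?z - ?y"]
      sqrt_bound_mono[of n] by linarith
  ultimately have "norm (sqrt_iter B (Suc (Suc n)) x - ?Z x)
      \<le> (?z * ((?z - ?y) * norm x) + (?z - ?y) * (?y * norm x)) / 2"
    by (meson add_mono divide_right_mono order_trans zero_le_numeral)
  also have "\<dots> = (?z\<^sup>2 - ?y\<^sup>2) / 2 * norm x"
    by (simp only: power2_eq_square) (simp add: algebra_simps del: sqrt_bound.simps)
  also have "(?z\<^sup>2 - ?y\<^sup>2) / 2 = sqrt_bound (Suc (Suc n)) - ?z"
    unfolding sqrt_bound.simps(2)[of "Suc n"] by (subst (3) sqrt_bound.simps(2)) (simp add: field_simps)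
  finally show ?case .
qed (use B(2) in auto)

lemma sqrt_iter_convergent:
  fixes B :: "'a::complex_hilbert_space \<Rightarrow> 'a"
  assumes B: "B \<in> bounded_ops" "\<And>x. norm (B x) \<le> norm x"
  shows "convergent (\<lambda>n. sqrt_iter B n x)"
proof -
  define b where "b n = sqrt_bound n * norm x" for n
  have le: "norm (sqrt_iter B m x - sqrt_iter B n x) \<le> b m - b n" if "n \<le> m" for m n
    using that
  proof (induction m rule: dec_induct)
    case (step m)
    have "sqrt_iter B (Suc m) x - sqrt_iter B n x
        = (sqrt_iter B (Suc m) x - sqrt_iter B m x) + (sqrt_iter B m x - sqrt_iter B n x)" by simp
    then have "norm (sqrt_iter B (Suc m) x - sqrt_iter B n x)
        \<le> norm (sqrt_iter B (Suc m) x - sqrt_iter B m x) + norm (sqrt_iter B m x - sqrt_iter B n x)"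
      by (metis norm_triangle_ineq)
    also have "\<dots> \<le> (b (Suc m) - b m) + (b m - b n)"
      using sqrt_iter_step[OF B, of m x] step(3) unfolding b_def left_diff_distrib by (rule add_mono)
    finally show ?case by simp
  qed simp
  have "convergent b"
    unfolding b_def by (rule convergent_mult[OF sqrt_bound_convergent convergent_const])
  then have "Cauchy b" by (rule convergent_Cauchy)
  have "Cauchy (\<lambda>n. sqrt_iter B n x)"
  proof (rule CauchyI')
    fix e :: real assume "0 < e"
    from CauchyD[OF \<open>Cauchy b\<close> this]
    obtain n0 where n0: "\<And>m n. m \<ge> n0 \<Longrightarrow> n \<ge> n0 \<Longrightarrow> norm (b m - b n) < e" by blast
    have "norm (sqrt_iter B m x - sqrt_iter B n x) < e" if "m \<ge> n0" "n > m" for m n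
      using le[of m n] n0[of n m] that by (simp add: norm_minus_commute)
    then show "\<exists>M. \<forall>m\<ge>M. \<forall>n>m. dist (sqrt_iter B m x) (sqrt_iter B n x) < e"
      unfolding dist_norm by blast
  qed
  then show ?thesis by (rule Cauchy_convergent)
qed

text \<open>Replacing \<open>A\<close> by \<open>1 - B\<close> with \<open>\<parallel>B\<parallel> \<le> 1\<close>, the iterates converge to the solution
  \<open>Y\<close> of \<open>Y = (B + Y\<^sup>2) / 2\<close>, for which \<open>(1 - Y)\<^sup>2 = 1 - B\<close>.\<close>

lemma positive_sqrt_exists:
  fixes A :: "'a::complex_hilbert_space \<Rightarrow> 'a"
  assumes A: "positive_op A"
  obtains S where "positive_op S" "S \<circ> S = A"
    and "\<And>C. bounded_linear C \<Longrightarrow> C \<circ> A = A \<circ> C \<Longrightarrow> C \<circ> S = S \<circ> C"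
proof -
  have bA: "A \<in> bounded_ops" using A by (simp add: positive_op_def)
  have symA: "symmetric_op A" by (rule positive_op_symmetric[OF A])
  obtain K where K: "K > 0" "\<And>x. norm (A x) \<le> K * norm x"
    using bounded_ops_bound[OF bA] by blast
  \<comment> \<open>As forms \<open>0 \<le> A \<le> K\<close>, hence
    \<open>0 \<le> B \<le> 1\<close> for \<open>B = 1 - A / K\<close>.\<close>
  define B where "B x = x - (1/K) *\<^sub>R A x" for x
  have B_add: "B (x + y) = B x + B y" for x y
    by (simp add: B_def bounded_ops_simps[OF bA] algebra_simps)
  have B_scale: "B (c *\<^sub>C x) = c *\<^sub>C B x" for c x
    by (simp add: B_def bounded_ops_simps[OF bA] scaleR_scaleC
        complex_vector.scale_right_diff_distrib complex_vector.scale_left_commute)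
  have symB: "symmetric_op B"
    by (simp add: symmetric_op_def B_def cinner_simps symmetric_opD[OF symA])
  have "norm (B x) \<le> norm x + 1/K * (K * norm x)" for x
    using norm_triangle_ineq4[of x "(1/K) *\<^sub>R A x"] mult_left_mono[OF K(2)[of x], of "1/K"] K(1)
    by (simp add: B_def)
  then have bB: "B \<in> bounded_ops"
    using K(1) by (intro bounded_opsI[where K = 2] B_add B_scale) simp
  have form: "Re (cinner (B x) x) = (norm x)\<^sup>2 - Re (cinner (A x) x) / K" for x
    by (simp add: B_def cinner_simps power2_norm_cinner)
  have B_ge: "0 \<le> Re (cinner (B x) x)" for x
    using quadratic_form_le[of A, OF K(2), of x] K(1) by (simp add: form field_simps)
  have B_le: "Re (cinner (B x) x) \<le> 1 * (norm x)\<^sup>2" for x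
    using positive_op_Re[OF A, of x] K(1) by (simp add: form)
  \<comment> \<open>The triangle inequality gives only the bound 2, but the iteration needs a
    contraction; this follows from \<open>B\<^sup>2 \<le> B \<le> 1\<close>.\<close>
  have nB: "norm (B x) \<le> norm x" for x
  proof -
    have "(norm (B x))\<^sup>2 \<le> 1 * Re (cinner (B x) x)"
      by (rule norm_sq_le_quadratic_form[where S = B and r = 1 and x = x, OF bB symB _ B_ge B_le]) simp
    also have "\<dots> \<le> (norm x)\<^sup>2" using B_le[of x] by simp
    finally show ?thesis by (rule power2_le_imp_le) simp
  qed
  define Y where "Y x = lim (\<lambda>n. sqrt_iter B n x)" for x
  have lim: "(\<lambda>n. sqrt_iter B n x) \<longlonglongrightarrow> Y x" for x
    using sqrt_iter_convergent[OF bB nB, of x] by (simp add: Y_def convergent_LIMSEQ_iff)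
  have Y_add: "Y (x + y) = Y x + Y y" for x y
    using lim[of "x + y"] tendsto_add[OF lim[of x] lim[of y]]
    by (simp add: sqrt_iter_linear[OF bB] LIMSEQ_unique)
  have bl_scale: "bounded_linear (\<lambda>x::'a. c *\<^sub>C x)" for c
    by (rule bounded_linear_intro[where K = "cmod c"])
      (simp_all add: complex_vector.scale_right_distrib scaleR_scaleC norm_scaleC
        complex_vector.scale_left_commute mult.commute)
  have Y_scale: "Y (c *\<^sub>C x) = c *\<^sub>C Y x" for c x
    using lim[of "c *\<^sub>C x"] bounded_linear.tendsto[OF bl_scale lim[of x], of c]
    by (simp add: sqrt_iter_linear[OF bB] LIMSEQ_unique)
  have iter_le: "norm (sqrt_iter B n x) \<le> norm x" for n x
    using sqrt_iter_bound[of B n x, OF nB] sqrt_bound_range[of n]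
      mult_right_mono[of "sqrt_bound n" 1 "norm x"] by simp
  have nY: "norm (Y x) \<le> norm x" for x
    by (rule LIMSEQ_le_const2[OF tendsto_norm[OF lim]]) (use iter_le in blast)
  have bY: "Y \<in> bounded_ops"
    by (rule bounded_opsI[where K = 1]) (use nY in \<open>simp_all add: Y_add Y_scale\<close>)
  have cont: "(\<lambda>n. cinner (f n) y) \<longlonglongrightarrow> cinner a y" if "f \<longlonglongrightarrow> a" for f a and y :: 'a
    using isCont_tendsto_compose[OF _ that, of "\<lambda>x. cinner x y"] continuous_on_cinner_left[of y]
    by (simp add: continuous_on_eq_continuous_at)
  have symY: "symmetric_op Y"
    unfolding symmetric_op_def
  proof (intro allI)
    fix x y
    have "(\<lambda>n. cinner (sqrt_iter B n x) y) \<longlonglongrightarrow> cnj (cinner (Y y) x)"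
      using tendsto_cnj[OF cont[OF lim[of y], of x]]
      by (simp add: symmetric_opD[OF sqrt_iter_symmetric[OF symB]] flip: cinner_commute)
    then show "cinner (Y x) y = cinner x (Y y)"
      using cont[OF lim[of x], of y] LIMSEQ_unique cinner_commute by metis
  qed
  have Y_eq: "Y x = (1/2) *\<^sub>R (B x + Y (Y x))" for x
  proof -
    \<comment> \<open>Pointwise limits of a product: split off the \<open>n\<close>-th iterate at
      \<open>Y x\<close>; the remainder tends to 0 since all iterates are contractions.\<close>
    have "(\<lambda>n. sqrt_iter B n (sqrt_iter B n x - Y x)) \<longlonglongrightarrow> 0"
    proof (rule Lim_null_comparison)
      show "\<forall>\<^sub>F n in sequentially. norm (sqrt_iter B n (sqrt_iter B n x - Y x))
          \<le> norm (sqrt_iter B n x - Y x)" by (simp add: iter_le)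
      show "(\<lambda>n. norm (sqrt_iter B n x - Y x)) \<longlonglongrightarrow> 0"
        using lim[of x] by (simp add: LIM_zero tendsto_norm_zero)
    qed
    from tendsto_add[OF this lim[of "Y x"]]
    have "(\<lambda>n. sqrt_iter B n (sqrt_iter B n x)) \<longlonglongrightarrow> Y (Y x)"
      by (simp add: sqrt_iter_diff[OF bB])
    then have "(\<lambda>n. sqrt_iter B (Suc n) x) \<longlonglongrightarrow> (1/2) *\<^sub>R (B x + Y (Y x))"
      by (simp only: sqrt_iter.simps) (intro tendsto_intros)
    then show ?thesis using LIMSEQ_Suc[OF lim[of x]] LIMSEQ_unique by blast
  qed
  \<comment> \<open>The factor \<open>sqrt K\<close> comes from
    \<open>A = K (1 - B) = K (1 - Y)\<^sup>2\<close>.\<close>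
  define S where "S x = sqrt K *\<^sub>R (x - Y x)" for x
  have S_add: "S (x + y) = S x + S y" for x y
    by (simp add: S_def Y_add algebra_simps)
  have S_scale: "S (c *\<^sub>C x) = c *\<^sub>C S x" for c x
    by (simp add: S_def Y_scale scaleR_scaleC complex_vector.scale_right_diff_distrib mult.commute)
  have "norm (x - Y x) \<le> 2 * norm x" for x
    using norm_triangle_ineq4[of x "Y x"] nY[of x] by simp
  then have "norm (S x) \<le> (sqrt K * 2) * norm x" for x
    using K(1) by (simp add: S_def)
  then have bS: "S \<in> bounded_ops"
    by (intro bounded_opsI S_add S_scale)
  have symS: "symmetric_op S"
    by (simp add: symmetric_op_def S_def cinner_simps symmetric_opD[OF symY])
  have posS: "positive_op S"
  proof (rule positive_opI[OF bS symS])
    fix x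
    have "Re (cinner (Y x) x) \<le> 1 * (norm x)\<^sup>2"
      by (rule quadratic_form_le) (simp add: nY)
    then show "0 \<le> Re (cinner (S x) x)"
      using K(1) by (simp add: S_def cinner_simps power2_norm_cinner)
  qed
  have SS: "S \<circ> S = A"
  proof
    fix x
    have "2 *\<^sub>R Y x = B x + Y (Y x)"
      by (subst Y_eq) simp
    then have "x - Y x - (Y x - Y (Y x)) = x - B x"
      by (simp add: scaleR_2 algebra_simps)
    moreover have "S (S x) = K *\<^sub>R (x - Y x - (Y x - Y (Y x)))"
      using K(1) by (simp add: S_def bounded_ops_simps[OF bY] scaleR_diff_right)
    ultimately show "(S \<circ> S) x = A x"
      using K(1) by (simp add: B_def)
  qed
  \<comment> \<open>\<open>C\<close> commutes with \<open>B\<close>, hence with each iterate, and by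
    continuity with the limit \<open>Y\<close>.\<close>
  have comm: "C \<circ> S = S \<circ> C" if C: "bounded_linear C" and CA: "C \<circ> A = A \<circ> C" for C
  proof
    fix x
    note lin = bounded_linear.linear[OF C]
    have "C (A y) = A (C y)" for y using CA by (metis comp_apply)
    then have "C \<circ> B = B \<circ> C"
      by (simp add: fun_eq_iff B_def linear_diff[OF lin] linear_scale[OF lin])
    then have "(\<lambda>n. C (sqrt_iter B n x)) \<longlonglongrightarrow> Y (C x)"
      using lim[of "C x"] by (simp add: sqrt_iter_commute[OF C])
    then have "C (Y x) = Y (C x)"
      using bounded_linear.tendsto[OF C lim[of x]] LIMSEQ_unique by blast
    then show "(C \<circ> S) x = (S \<circ> C) x"
      by (simp add: S_def linear_diff[OF lin] linear_scale[OF lin])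
  qed
  show thesis using that posS SS comm by blast
qed

text \<open>Uniqueness makes the \<open>THE\<close> denote the constructed root \<open>S\<close>.
  Another root \<open>R\<close> commutes with \<open>A = R \<circ> R\<close>, hence with
  \<open>S\<close>. For \<open>D = S - R\<close> this gives \<open>(S + R) D = 0\<close>; both forms
  are nonnegative, so \<open>S D = R D = 0\<close>, thus \<open>D\<^sup>2 = 0\<close>, and symmetry
  gives \<open>D = 0\<close>.\<close>

lemma sqrt_op_properties:
  fixes A :: "'a::complex_hilbert_space \<Rightarrow> 'a"
  assumes "positive_op A"
  shows "positive_op (sqrt_op A)" and "sqrt_op A \<circ> sqrt_op A = A"
proof -
  obtain S where S: "positive_op S" "S \<circ> S = A"
    and comm: "\<And>C. bounded_linear C \<Longrightarrow> C \<circ> A = A \<circ> C \<Longrightarrow> C \<circ> S = S \<circ> C"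
    using positive_sqrt_exists[OF assms] by blast
  have "positive_op (sqrt_op A) \<and> sqrt_op A \<circ> sqrt_op A = A"
    unfolding sqrt_op_def
  proof (rule theI[of _ S])
    fix R assume R: "positive_op R \<and> R \<circ> R = A"
    have bR: "R \<in> bounded_ops" and bS: "S \<in> bounded_ops"
      using R S by (auto simp: positive_op_def)
    have "R \<circ> S = S \<circ> R"
      using R by (intro comm bounded_ops_bounded_linear[OF bR]) (auto simp: comp_assoc)
    then have RS: "R (S x) = S (R x)" for x by (metis comp_apply)
    have RR: "R (R x) = S (S x)" for x using R S(2) by (metis comp_apply)
    define D where "D x = S x - R x" for x
    have "D x = 0" for x
    proof -
      have "S (D x) + R (D x) = 0"
        by (simp add: D_def bounded_ops_simps[OF bS] bounded_ops_simps[OF bR] RS RR)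
      then have "Re (cinner (S (D x)) (D x)) + Re (cinner (R (D x)) (D x)) = 0"
        by (metis cinner_add_left cinner_zero_left plus_complex.sel(1) zero_complex.sel(1))
      then have "Re (cinner (S (D x)) (D x)) = 0" "Re (cinner (R (D x)) (D x)) = 0"
        using positive_op_Re[OF S(1), of "D x"] positive_op_Re[of R "D x"] R by auto
      then have "S (D x) = 0" "R (D x) = 0"
        using positive_op_kernel S(1) R by blast+
      moreover have "cinner (D x) (D x) = cinner x (S (D x) - R (D x))"
        using symmetric_opD[OF positive_op_symmetric[OF S(1)], of x "D x"]
          symmetric_opD[OF positive_op_symmetric, of R x "D x"] R
        by (simp add: D_def[of x] cinner_simps algebra_simps)
      ultimately show "D x = 0" by (simp add: cinner_self_eq_zero)
    qed
    then show "R = S" by (simp add: D_def fun_eq_iff)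
  qed (use S in simp)
  then show "positive_op (sqrt_op A)" "sqrt_op A \<circ> sqrt_op A = A" by auto
qed

section \<open>The absolute value of an operator\<close>

lemma cadjoint_comp_self:
  fixes T :: "'a::complex_hilbert_space \<Rightarrow> 'a"
  assumes T: "T \<in> bounded_ops"
  shows "cinner ((cadjoint T \<circ> T) x) y = cinner (T x) (T y)"
  using cinner_cadjoint[OF T, of y "T x"] cinner_commute by (metis comp_apply)

lemma positive_op_cadjoint_comp_self:
  fixes T :: "'a::complex_hilbert_space \<Rightarrow> 'a"
  assumes T: "T \<in> bounded_ops"
  shows "positive_op (cadjoint T \<circ> T)"
  using bounded_ops_comp[OF cadjoint_bounded_ops[OF T] T]
  unfolding positive_op_def cadjoint_comp_self[OF T] by (simp add: cinner_self_nonneg)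

text \<open>Both squared norms are the form of \<open>cadjoint T \<circ> T\<close> at
  \<open>x\<close>. Consequently minimum moduli and minimisers agree on every subspace.\<close>

lemma norm_abs_op:
  fixes T :: "'a::complex_hilbert_space \<Rightarrow> 'a"
  assumes T: "T \<in> bounded_ops"
  shows "norm (abs_op T x) = norm (T x)"
proof -
  note P = sqrt_op_properties[OF positive_op_cadjoint_comp_self[OF T], folded abs_op_def]
  have "cinner (abs_op T x) (abs_op T x) = cinner ((abs_op T \<circ> abs_op T) x) x"
    using symmetric_opD[OF positive_op_symmetric[OF P(1)], of "abs_op T x" x] by simp
  also have "\<dots> = cinner (T x) (T x)"
    unfolding P(2) by (rule cadjoint_comp_self[OF T])
  finally show ?thesis by (simp add: norm_eq_sqrt_cinner)
qed

section \<open>Vectors on which a symmetric operator has spectral radius at most \<open>r\<close>\<close>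

text \<open>Log-convexity makes the ratios of consecutive terms nondecreasing. If the first ratio
  \<open>q\<close> exceeded \<open>r\<close>, then \<open>a n\<close> would grow at least like
  \<open>q ^ n\<close> and overtake \<open>C * r ^ n\<close>.\<close>

lemma log_convex_growth:
  fixes a :: "nat \<Rightarrow> real"
  assumes pos: "a 0 > 0" and nonneg: "\<And>n. a n \<ge> 0"
    and log: "\<And>n. (a (Suc n))\<^sup>2 \<le> a n * a (Suc (Suc n))"
    and bound: "\<And>n. a n \<le> C * r ^ n" and r: "r > 0"
  shows "a (Suc 0) \<le> r * a 0"
proof (rule ccontr)
  define q where "q = a (Suc 0) / a 0"
  assume "\<not> a (Suc 0) \<le> r * a 0"
  then have q: "q > r" using pos by (simp add: q_def field_simps)
  have step: "a n > 0 \<and> q * a n \<le> a (Suc n)" for n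
  proof (induction n)
    case (Suc n)
    have p: "a (Suc n) > 0"
      using Suc q r by (metis less_le_trans mult_pos_pos order_less_trans)
    have "a n * (q * a (Suc n)) \<le> a (Suc n) * a (Suc n)"
      using mult_right_mono[of "q * a n" "a (Suc n)" "a (Suc n)"] Suc p by (simp add: ac_simps)
    also have "\<dots> \<le> a n * a (Suc (Suc n))" using log[of n] by (simp add: power2_eq_square)
    finally show ?case using p Suc by simp
  qed (use pos in \<open>simp add: q_def\<close>)
  have grow: "a 0 * q ^ n \<le> a n" for n
  proof (induction n)
    case (Suc n)
    have "a 0 * q ^ Suc n = q * (a 0 * q ^ n)" by simp
    also have "\<dots> \<le> q * a n" using Suc q r by (intro mult_left_mono) auto
    finally show ?case using step[of n] by linarith
  qed simp
  have "q / r > 1" using q r by simp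
  then obtain n where "C / a 0 < (q / r) ^ n" using real_arch_pow by blast
  moreover have "a 0 * q ^ n \<le> C * r ^ n" using grow[of n] bound[of n] by linarith
  ultimately show False
    using pos r by (simp add: field_simps)
qed

text \<open>For a bounded symmetric \<open>S\<close> on a Hilbert space and \<open>r > 0\<close>,
  this is the range of the spectral projection for \<open>[-r, r]\<close>. Fixing the constant as
  \<open>norm x\<close> makes the set visibly closed; \<open>spectral_partI\<close> restores the
  freedom of an arbitrary constant.\<close>

definition spectral_part :: "('a::complex_inner \<Rightarrow> 'a) \<Rightarrow> real \<Rightarrow> 'a set" where
  "spectral_part S r = {x. \<forall>n. norm ((S ^^ n) x) \<le> r ^ n * norm x}"

lemma funpow_bounded_ops:
  assumes "S \<in> bounded_ops"
  shows "S ^^ n \<in> bounded_ops"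
proof (induction n)
  case 0
  show ?case by (rule bounded_opsI[where K = 1]) auto
next
  case (Suc n)
  then show ?case using bounded_ops_comp[OF assms] by (simp only: funpow.simps)
qed

lemma spectral_partI:
  assumes S: "symmetric_op S" "S \<in> bounded_ops" and r: "r > 0"
    and x: "\<And>n. norm ((S ^^ n) x) \<le> C * r ^ n"
  shows "x \<in> spectral_part S r"
proof -
  define a where "a n = norm ((S ^^ n) x)" for n
  have log: "(a (Suc n))\<^sup>2 \<le> a n * a (Suc (Suc n))" for n
  proof -
    \<comment> \<open>Symmetry moves one factor \<open>S\<close> across; Cauchy-Schwarz then gives
      log-convexity.\<close>
    have "(a (Suc n))\<^sup>2 = Re (cinner ((S ^^ n) x) ((S ^^ Suc (Suc n)) x))"
      by (simp add: a_def power2_norm_cinner symmetric_opD[OF S(1)])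
    then show ?thesis using Re_cinner_le by (simp only: a_def)
  qed
  \<comment> \<open>The growth lemma is applied to the sequence shifted by \<open>n\<close>, whose
    constant is \<open>C * r ^ n\<close>.\<close>
  have step: "a (Suc n) \<le> r * a n" for n
  proof (cases "a n = 0")
    case True
    then show ?thesis by (simp add: a_def bounded_ops_simps[OF S(2)])
  next
    case False
    then have "a (0 + n) > 0" by (simp add: a_def)
    moreover have "a (k + n) \<le> (C * r ^ n) * r ^ k" for k
      using x[of "k + n"] by (simp add: a_def power_add mult.assoc mult.commute[of "r ^ n"])
    ultimately show ?thesis
      using log_convex_growth[of "\<lambda>k. a (k + n)" "C * r ^ n" r] log r by (simp add: a_def)
  qed
  have "a n \<le> r ^ n * norm x" for n
  proof (induction n)
    case (Suc n)
    then show ?case using step[of n] order_trans[OF _ mult_left_mono[of "a n" "r ^ n * norm x" r]] r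
      by (simp add: mult.assoc)
  qed (simp add: a_def)
  then show ?thesis by (simp add: spectral_part_def a_def)
qed

lemma closed_csubspace_spectral_part:
  assumes S: "symmetric_op S" "S \<in> bounded_ops" and r: "r > 0"
  shows "closed_csubspace (spectral_part S r)"
proof -
  note lin = bounded_ops_simps[OF funpow_bounded_ops[OF S(2)]]
  have "x + y \<in> spectral_part S r" if "x \<in> spectral_part S r" "y \<in> spectral_part S r" for x y
  proof (rule spectral_partI[OF S r])
    fix n
    show "norm ((S ^^ n) (x + y)) \<le> (norm x + norm y) * r ^ n"
      using that norm_triangle_mono[of "(S ^^ n) x" "r ^ n * norm x" "(S ^^ n) y" "r ^ n * norm y"]
      unfolding spectral_part_def lin by (simp add: algebra_simps)
  qed
  moreover have "c *\<^sub>C x \<in> spectral_part S r" if "x \<in> spectral_part S r" for c x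
    using that by (simp add: spectral_part_def lin norm_scaleC mult_left_mono mult.left_commute)
  moreover have "0 \<in> spectral_part S r" by (simp add: spectral_part_def lin)
  ultimately have "complex_vector.subspace (spectral_part S r)"
    by (simp add: complex_vector.subspace_def)
  moreover have "closed (spectral_part S r)"
    unfolding spectral_part_def
    by (intro closed_Collect_all closed_Collect_le continuous_intros linear_continuous_on
        bounded_ops_bounded_linear funpow_bounded_ops S)
  ultimately show ?thesis by (simp add: closed_csubspace_def)
qed

text \<open>Commuting with \<open>S\<close> costs only a norm bound of \<open>C\<close>, which the
  free constant in \<open>spectral_partI\<close> absorbs.\<close>

lemma spectral_part_invariant:
  assumes S: "symmetric_op S" "S \<in> bounded_ops" and r: "r > 0"
    and C: "C \<in> bounded_ops" "\<And>x. C (S x) = S (C x)" and x: "x \<in> spectral_part S r"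
  shows "C x \<in> spectral_part S r"
proof -
  obtain K where K: "K > 0" "\<And>x. norm (C x) \<le> K * norm x" using bounded_ops_bound[OF C(1)] by blast
  have comm: "(S ^^ n) (C x) = C ((S ^^ n) x)" for n
    by (induction n) (simp_all add: C(2))
  show ?thesis
  proof (rule spectral_partI[OF S r])
    fix n
    have "norm ((S ^^ n) (C x)) \<le> K * norm ((S ^^ n) x)" unfolding comm by (rule K)
    also have "\<dots> \<le> K * (r ^ n * norm x)"
      using x K(1) by (intro mult_left_mono) (auto simp: spectral_part_def)
    finally show "norm ((S ^^ n) (C x)) \<le> (K * norm x) * r ^ n" by (simp add: ac_simps)
  qed
qed

text \<open>On \<open>M\<close> the form inequality
  \<open>S\<^sup>2 \<le> r S \<le> r\<^sup>2\<close> gives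
  \<open>norm (S x) \<le> r * norm x\<close>; invariance lets this be iterated.\<close>

lemma invariant_subset_spectral_part:
  assumes S: "symmetric_op S" "S \<in> bounded_ops" and r: "r > 0"
    and M: "closed_csubspace M" "S ` M \<subseteq> M"
    and ge: "\<And>x. x \<in> M \<Longrightarrow> 0 \<le> Re (cinner (S x) x)"
    and le: "\<And>x. x \<in> M \<Longrightarrow> Re (cinner (S x) x) \<le> r * (norm x)\<^sup>2"
  shows "M \<subseteq> spectral_part S r"
proof
  have step: "norm (S x) \<le> r * norm x" if x: "x \<in> M" for x
  proof -
    have Sx: "S x \<in> M" using x M by blast
    have "(norm (S x))\<^sup>2 \<le> r * Re (cinner (S x) x)"
      by (intro norm_sq_le_quadratic_form S r ge le Sx closed_csubspace_diff[OF M(1)]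
          closed_csubspace_scaleR[OF M(1)] x)
    also have "\<dots> \<le> r * (r * (norm x)\<^sup>2)"
      using le[OF x] r by (intro mult_left_mono) auto
    also have "\<dots> = (r * norm x)\<^sup>2" by (simp add: power2_eq_square)
    finally show ?thesis by (rule power2_le_imp_le) (use r in simp)
  qed
  fix x assume x: "x \<in> M"
  have "(S ^^ n) x \<in> M \<and> norm ((S ^^ n) x) \<le> r ^ n * norm x" for n
  proof (induction n)
    case (Suc n)
    then have "norm (S ((S ^^ n) x)) \<le> r * (r ^ n * norm x)"
      using order_trans[OF step[of "(S ^^ n) x"] mult_left_mono[of _ "r ^ n * norm x" r]] r
      by simp
    then show ?case using Suc M(2) by (auto simp: mult.assoc)
  qed (simp add: x)
  then show "x \<in> spectral_part S r" by (simp add: spectral_part_def)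
qed

section \<open>Passing to the absolute value\<close>

text \<open>Let \<open>z\<close> be the projection of \<open>k\<close> onto \<open>M\<close>. Then
  \<open>(A - \<mu>) z\<close> lies in \<open>M\<close>, but it equals
  \<open>- (A - \<mu>) (k - z)\<close>, which is orthogonal to \<open>M\<close> by symmetry and
  invariance. So it is 0, and \<open>none\<close> yields \<open>z = 0\<close>.\<close>

lemma eigenspace_orthogonal:
  fixes A :: "'a::complex_hilbert_space \<Rightarrow> 'a"
  assumes A: "symmetric_op A" "A \<in> bounded_ops"
    and M: "closed_csubspace M" "A ` M \<subseteq> M"
    and none: "\<And>x. x \<in> M \<Longrightarrow> A x = \<mu> *\<^sub>R x \<Longrightarrow> x = 0"
    and k: "A k = \<mu> *\<^sub>R k" and x: "x \<in> M"
  shows "cinner x k = 0"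
proof -
  obtain z where z: "z \<in> M" "\<And>x. x \<in> M \<Longrightarrow> cinner x (k - z) = 0"
    using projection_exists[OF M(1)] by blast
  define w where "w = A z - \<mu> *\<^sub>R z"
  have w: "w \<in> M"
    unfolding w_def using z(1) M by (intro closed_csubspace_diff closed_csubspace_scaleR) auto
  have "A w \<in> M" using w M(2) by blast
  have "w = - (A (k - z) - \<mu> *\<^sub>R (k - z))"
    by (simp add: w_def bounded_ops_simps[OF A(2)] k algebra_simps)
  then have "cinner w w = - (cinner (A w) (k - z) - \<mu> * cinner w (k - z))"
    by (metis cinner_diff_right cinner_minus_right cinner_scaleR_right symmetric_opD[OF A(1)])
  also have "\<dots> = 0" using z(2) w \<open>A w \<in> M\<close> by simp
  finally have "w = 0" by (simp add: cinner_self_eq_zero)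
  then have "z = 0" using none z(1) by (simp add: w_def)
  then show ?thesis using z(2) x by simp
qed

section \<open>Minimum modulus and reducing subspaces\<close>

lemma bdd_below_norm_image: "bdd_below ((\<lambda>x. norm (T x)) ` X)"
  by (rule bdd_belowI[where m = 0]) auto

lemma min_modulus_on_le:
  assumes T: "T \<in> bounded_ops" and M: "closed_csubspace M" and x: "x \<in> M"
  shows "min_modulus_on M T * norm x \<le> norm (T x)"
proof (cases "x = 0")
  case False
  define u where "u = (1 / norm x) *\<^sub>R x"
  have "u \<in> M" "norm u = 1"
    using False x M by (auto simp: u_def closed_csubspace_scaleR)
  then have "min_modulus_on M T \<le> norm (T u)"
    unfolding min_modulus_on_def by (intro cINF_lower bdd_below_norm_image) auto
  also have "norm (T u) = norm (T x) / norm x"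
    by (simp add: u_def bounded_ops_simps[OF T])
  finally show ?thesis using False by (simp add: field_simps)
qed simp

lemma closed_csubspace_unit_vector:
  assumes M: "closed_csubspace M" "M \<noteq> {0}"
  obtains u where "u \<in> M" "norm u = 1"
proof -
  obtain x where "x \<in> M" "x \<noteq> 0"
    using M by (metis closed_csubspace_def complex_vector.subspace_0 insertI1 subsetI
        subset_singletonD empty_iff)
  then have "(1 / norm x) *\<^sub>R x \<in> M" "norm ((1 / norm x) *\<^sub>R x) = 1"
    using M by (auto simp: closed_csubspace_scaleR)
  then show thesis by (rule that)
qed

lemma closed_csubspace_orthogonal:
  "closed_csubspace {x. \<forall>k. P k \<longrightarrow> cinner x k = 0}"
proof -
  have "complex_vector.subspace {x. \<forall>k. P k \<longrightarrow> cinner x k = 0}"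
    by (simp add: complex_vector.subspace_def cinner_simps)
  moreover have "closed {x. \<forall>k. P k \<longrightarrow> cinner x k = 0}"
    by (intro closed_Collect_all closed_Collect_imp closed_Collect_eq continuous_on_cinner_left
        continuous_intros open_Collect_const)
  ultimately show ?thesis by (simp add: closed_csubspace_def)
qed

lemma bounded_ops_shift:
  assumes A: "A \<in> bounded_ops"
  shows "(\<lambda>x. c *\<^sub>R x - A x) \<in> bounded_ops"
proof -
  obtain L where L: "L > 0" "\<And>x. norm (A x) \<le> L * norm x"
    using bounded_ops_bound[OF A] by blast
  show ?thesis
  proof (rule bounded_opsI)
    show "norm (c *\<^sub>R x - A x) \<le> (\<bar>c\<bar> + L) * norm x" for x
      using norm_triangle_ineq4[of "c *\<^sub>R x" "A x"] L(2)[of x]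
      by (simp add: algebra_simps)
  qed (simp_all add: bounded_ops_simps[OF A] scaleR_scaleC scaleC_add_right
      complex_vector.scale_right_diff_distrib complex_vector.scale_left_commute)
qed

lemma symmetric_op_shift:
  "symmetric_op A \<Longrightarrow> symmetric_op (\<lambda>x. c *\<^sub>R x - A x)"
  by (simp add: symmetric_op_def cinner_simps)

text \<open>Equality case of Cauchy-Schwarz: \<open>norm (S x) \<le> r\<close> together with the
  lower bound on the form forces \<open>norm (S x - r *\<^sub>R x) = 0\<close>.\<close>

lemma spectral_part_eigenvector:
  assumes r: "r > 0" and x: "x \<in> spectral_part S r" "norm x = 1" "r \<le> Re (cinner (S x) x)"
  shows "S x = r *\<^sub>R x"
proof -
  have "norm ((S ^^ 1) x) \<le> r ^ 1 * norm x"
    using x(1) unfolding spectral_part_def by blast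
  then have le: "norm (S x) \<le> r" by (simp add: x(2))
  have "(norm (S x - r *\<^sub>R x))\<^sup>2 = (norm (S x))\<^sup>2 - 2 * r * Re (cinner (S x) x) + r\<^sup>2"
    using r by (simp add: norm_diff_sq cinner_simps x(2))
  also have "\<dots> \<le> r\<^sup>2 - 2 * r * r + r\<^sup>2"
    using x(3) le r by (intro add_right_mono diff_mono power_mono mult_left_mono) auto
  finally have "(norm (S x - r *\<^sub>R x))\<^sup>2 \<le> 0" by (simp add: power2_eq_square)
  then show ?thesis by simp
qed

text \<open>\<open>C\<close> preserves the orthogonal complement of \<open>E\<close> because its
  adjoint \<open>D\<close> preserves \<open>E\<close>. The roles of \<open>C\<close> and
  \<open>D\<close> are later played by \<open>T\<close> and \<open>cadjoint T\<close>, in both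
  orders.\<close>

lemma spectral_part_orthogonal_invariant:
  assumes S: "symmetric_op S" "S \<in> bounded_ops" and r: "r > 0"
    and C: "C \<in> bounded_ops" "\<And>x. C (S x) = S (C x)"
    and adj: "\<And>x y. cinner (C x) y = cinner x (D y)" and D: "\<And>k. E k \<Longrightarrow> E (D k)"
  shows "C ` (spectral_part S r \<inter> {x. \<forall>k. E k \<longrightarrow> cinner x k = 0})
    \<subseteq> spectral_part S r \<inter> {x. \<forall>k. E k \<longrightarrow> cinner x k = 0}"
proof
  fix y assume "y \<in> C ` (spectral_part S r \<inter> {x. \<forall>k. E k \<longrightarrow> cinner x k = 0})"
  then obtain x where x: "x \<in> spectral_part S r" "\<And>k. E k \<Longrightarrow> cinner x k = 0" and y: "y = C x"
    by blast
  have "C x \<in> spectral_part S r"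
    using spectral_part_invariant[OF S r C(1) _ x(1)] C(2) by blast
  moreover have "cinner (C x) k = 0" if "E k" for k
    unfolding adj by (rule x(2)[OF D[OF that]])
  ultimately show "y \<in> spectral_part S r \<inter> {x. \<forall>k. E k \<longrightarrow> cinner x k = 0}"
    unfolding y by blast
qed

lemma reduces_spectral_part_orthogonal:
  fixes T :: "'a::complex_hilbert_space \<Rightarrow> 'a"
  assumes T: "T \<in> bounded_ops" "quasinormal T" and r: "r > 0"
    and A: "A = cadjoint T \<circ> T" and S: "S = (\<lambda>x. c *\<^sub>R x - A x)"
  shows "reduces (spectral_part S r \<inter> {x. \<forall>k. A k = \<mu> *\<^sub>R k \<longrightarrow> cinner x k = 0}) T"
proof -
  note T' = cadjoint_bounded_ops[OF T(1)]
  have bA: "A \<in> bounded_ops" unfolding A by (rule bounded_ops_comp[OF T' T(1)])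
  have symA: "symmetric_op A"
    unfolding A by (rule positive_op_symmetric[OF positive_op_cadjoint_comp_self[OF T(1)]])
  have bS: "S \<in> bounded_ops" unfolding S by (rule bounded_ops_shift[OF bA])
  have symS: "symmetric_op S" unfolding S by (rule symmetric_op_shift[OF symA])
  have TA: "T (A x) = A (T x)" for x
    using T(2) unfolding quasinormal_def A[symmetric] by (metis comp_apply)
  \<comment> \<open>Take adjoints in \<open>TA\<close>, using that \<open>A\<close> is
    symmetric.\<close>
  have T'A: "cadjoint T (A x) = A (cadjoint T x)" for x
    by (rule cinner_eqI) (simp add: TA flip: cinner_cadjoint[OF T(1)] symmetric_opD[OF symA])
  have adj': "cinner (cadjoint T x) y = cinner x (T y)" for x y
    using cinner_cadjoint[OF T(1), of y x] cinner_commute by metis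
  have "closed_csubspace (spectral_part S r \<inter> {x. \<forall>k. A k = \<mu> *\<^sub>R k \<longrightarrow> cinner x k = 0})"
    by (intro closed_csubspace_Int closed_csubspace_spectral_part[OF symS bS r]
        closed_csubspace_orthogonal)
  moreover have "T (S x) = S (T x)" "cadjoint T (S x) = S (cadjoint T x)" for x
    by (simp_all add: S TA T'A bounded_ops_simps[OF T(1)] bounded_ops_simps[OF T'])
  moreover have "A (T k) = \<mu> *\<^sub>R T k" "A (cadjoint T k) = \<mu> *\<^sub>R cadjoint T k"
    if "A k = \<mu> *\<^sub>R k" for k
    by (simp_all add: that bounded_ops_simps[OF T(1)] bounded_ops_simps[OF T'] flip: TA T'A)
  ultimately show ?thesis
    using spectral_part_orthogonal_invariant[where C = T and D = "cadjoint T"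
        and E = "\<lambda>k. A k = \<mu> *\<^sub>R k", OF symS bS r T(1) _ cinner_cadjoint[OF T(1)]]
      spectral_part_orthogonal_invariant[where C = "cadjoint T" and D = T
        and E = "\<lambda>k. A k = \<mu> *\<^sub>R k", OF symS bS r T' _ adj']
    by (simp add: reduces_def)
qed

lemma min_attaining_onI:
  assumes T: "T \<in> bounded_ops" and M: "closed_csubspace M"
    and x: "x \<in> M" "x \<noteq> 0" "norm (T x) = min_modulus_on M T * norm x"
  shows "min_attaining_on M T"
proof -
  have "norm (T ((1 / norm x) *\<^sub>R x)) = min_modulus_on M T"
    using x(2,3) by (simp add: bounded_ops_simps[OF T])
  moreover have "(1 / norm x) *\<^sub>R x \<in> M" by (rule closed_csubspace_scaleR[OF M x(1)])
  moreover have "norm ((1 / norm x) *\<^sub>R x) = 1" using x(2) by simp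
  ultimately show ?thesis unfolding min_attaining_on_def by blast
qed

lemma min_attaining_on_invariant:
  fixes T :: "'a::complex_hilbert_space \<Rightarrow> 'a"
  assumes T: "T \<in> \<M>\<^sub>r" and qn: "quasinormal T"
    and M: "closed_csubspace M" "M \<noteq> {0}" "(cadjoint T \<circ> T) ` M \<subseteq> M"
  shows "min_attaining_on M T"
proof -
  have bT: "T \<in> bounded_ops" using T by (simp add: min_attaining_reducing_def)
  define A where "A = cadjoint T \<circ> T"
  have bA: "A \<in> bounded_ops"
    unfolding A_def by (rule bounded_ops_comp[OF cadjoint_bounded_ops[OF bT] bT])
  have symA: "symmetric_op A"
    unfolding A_def by (rule positive_op_symmetric[OF positive_op_cadjoint_comp_self[OF bT]])
  have form: "Re (cinner (A x) x) = (norm (T x))\<^sup>2" for x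
    unfolding A_def cadjoint_comp_self[OF bT] by (simp add: power2_norm_cinner)
  define m where "m = min_modulus_on M T"
  define \<mu> where "\<mu> = m\<^sup>2"
  obtain u where u: "u \<in> M" "norm u = 1"
    using closed_csubspace_unit_vector[OF M(1,2)] by blast
  have m0: "m \<ge> 0"
    unfolding m_def min_modulus_on_def using u by (intro cINF_greatest) auto
  have low: "\<mu> * (norm x)\<^sup>2 \<le> (norm (T x))\<^sup>2" if "x \<in> M" for x
    using power_mono[OF min_modulus_on_le[OF bT M(1) that], of 2] m0
    by (simp add: \<mu>_def m_def power_mult_distrib)
  obtain K where K: "K > 0" "\<And>x. norm (T x) \<le> K * norm x"
    using bounded_ops_bound[OF bT] by blast
  \<comment> \<open>\<open>K\<^sup>2\<close> already makes \<open>S\<close> positive; the extra 1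
    gives \<open>r > 0\<close> even when \<open>\<mu> = K\<^sup>2\<close>.\<close>
  define c where "c = K\<^sup>2 + 1"
  define r where "r = c - \<mu>"
  have up: "(norm (T x))\<^sup>2 \<le> K\<^sup>2 * (norm x)\<^sup>2" for x
    using power_mono[OF K(2)[of x], of 2] by (simp add: power_mult_distrib)
  have r: "r > 0" using low[OF u(1)] up[of u] u(2) by (simp add: r_def c_def)
  define S where "S = (\<lambda>x. c *\<^sub>R x - A x)"
  have bS: "S \<in> bounded_ops" unfolding S_def by (rule bounded_ops_shift[OF bA])
  have symS: "symmetric_op S" unfolding S_def by (rule symmetric_op_shift[OF symA])
  have formS: "Re (cinner (S x) x) = c * (norm x)\<^sup>2 - (norm (T x))\<^sup>2" for x
    by (simp add: S_def cinner_simps form flip: power2_norm_cinner)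
  have AM: "A ` M \<subseteq> M" unfolding A_def by (rule M(3))
  have SM: "S ` M \<subseteq> M"
    unfolding S_def using AM closed_csubspace_diff[OF M(1) closed_csubspace_scaleR[OF M(1)]] by blast
  have "0 \<le> Re (cinner (S x) x)" for x
  proof -
    have "c * (norm x)\<^sup>2 = K\<^sup>2 * (norm x)\<^sup>2 + (norm x)\<^sup>2" by (simp add: c_def distrib_right)
    then show ?thesis using up[of x] zero_le_power2[of "norm x"] unfolding formS by linarith
  qed
  moreover have "Re (cinner (S x) x) \<le> r * (norm x)\<^sup>2" if "x \<in> M" for x
    using low[OF that] by (simp add: formS r_def left_diff_distrib)
  ultimately have MS: "M \<subseteq> spectral_part S r"
    by (intro invariant_subset_spectral_part[OF symS bS r M(1) SM])
  show ?thesis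
  proof (cases "\<exists>x\<in>M. x \<noteq> 0 \<and> A x = \<mu> *\<^sub>R x")
    case True
    then obtain x where x: "x \<in> M" "x \<noteq> 0" "A x = \<mu> *\<^sub>R x" by blast
    have "(norm (T x))\<^sup>2 = (m * norm x)\<^sup>2"
      unfolding form[symmetric] x(3)
      by (simp add: cinner_simps cinner_self \<mu>_def power_mult_distrib)
    then have "norm (T x) = m * norm x" using m0 by simp
    then show ?thesis
      unfolding m_def by (rule min_attaining_onI[OF bT M(1) x(1,2)])
  next
    case False
    define N where "N = spectral_part S r \<inter> {x. \<forall>k. A k = \<mu> *\<^sub>R k \<longrightarrow> cinner x k = 0}"
    have MN: "M \<subseteq> N"
      using MS eigenspace_orthogonal[OF symA bA M(1) AM, of \<mu>] False unfolding N_def by blast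
    have "reduces N T"
      unfolding N_def by (rule reduces_spectral_part_orthogonal[OF bT qn r A_def S_def])
    moreover have "N \<noteq> {0}" using MN u by auto
    ultimately have "min_attaining_on N T"
      using T by (simp add: min_attaining_reducing_def)
    then obtain x where x: "x \<in> N" "norm x = 1" "norm (T x) = min_modulus_on N T"
      unfolding min_attaining_on_def by blast
    \<comment> \<open>Enlarging the subspace can only lower the infimum. The minimiser
      \<open>x\<close> on \<open>N\<close> thus has form value at least \<open>r\<close> under
      \<open>S\<close>, which makes it an eigenvector.\<close>
    have "min_modulus_on N T \<le> m"
      unfolding m_def min_modulus_on_def
      using MN u by (intro cINF_superset_mono bdd_below_norm_image) auto
    then have "(norm (T x))\<^sup>2 \<le> \<mu>"
      unfolding x(3)[symmetric] \<mu>_def by (rule power_mono) simp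
    then have "r \<le> Re (cinner (S x) x)" by (simp add: formS r_def x(2))
    moreover have "x \<in> spectral_part S r" using x(1) by (simp add: N_def)
    ultimately have "S x = r *\<^sub>R x" using spectral_part_eigenvector[OF r] x(2) by blast
    then have "A x = \<mu> *\<^sub>R x" by (simp add: S_def r_def scaleR_diff_left)
    \<comment> \<open>Being in \<open>N\<close>, \<open>x\<close> is orthogonal to the eigenspace
      that contains it.\<close>
    then have "cinner x x = 0" using x(1) by (simp add: N_def)
    then show ?thesis using x(2) by (simp add: cinner_self_eq_zero)
  qed
qed

theorem proposition6p1:
  fixes T :: "'a::complex_hilbert_space \<Rightarrow> 'a"
  assumes "\<not> finite_dimensional TYPE('a)"
    and "separable_space (euclidean :: 'a topology)"
    and "T \<in> \<M>\<^sub>r"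
    and "quasinormal T"
  shows "abs_op T \<in> \<M>\<^sub>r"
proof -
  have bT: "T \<in> bounded_ops" using assms(3) by (simp add: min_attaining_reducing_def)
  note P = sqrt_op_properties[OF positive_op_cadjoint_comp_self[OF bT], folded abs_op_def]
  have "min_attaining_on M (abs_op T)" if M: "M \<noteq> {0}" "reduces M (abs_op T)" for M
  proof -
    \<comment> \<open>Invariance under the square of \<open>abs_op T\<close>, that is under
      \<open>cadjoint T \<circ> T\<close>, is all that passes from \<open>abs_op T\<close> to
      \<open>T\<close>.\<close>
    have "(abs_op T \<circ> abs_op T) ` M \<subseteq> M" using M(2) by (auto simp: reduces_def)
    then have "min_attaining_on M T"
      using M by (intro min_attaining_on_invariant assms(3,4)) (auto simp: reduces_def P(2))
    then show ?thesis
      by (simp add: min_attaining_on_def min_modulus_on_def norm_abs_op[OF bT])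
  qed
  then show ?thesis using P(1) by (auto simp: min_attaining_reducing_def positive_op_def)
qed

end
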